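(* Let $A$ be a Hermitian (complex) $n\times n$ matrix and let $\mathcal{S},\mathcal{T}\subseteq\{1,\ldots,n\}$ be such that $|\mathcal{S}\cap\mathcal{T}|=|\mathcal{S}|-1=|\mathcal{T}|-1$. Then for any $z\in\mathbb{R}$, $$\det\big(zI_{|\mathcal{S}\cup\mathcal{T}|}-A[\mathcal{S}\cup\mathcal{T}]\big)\det\big(zI_{|\mathcal{S}\cap\mathcal{T}|}-A[\mathcal{S}\cap\mathcal{T}]\big)\le\det\big(zI_{|\mathcal{S}|}-A[\mathcal{S}]\big)\det\big(zI_{|\mathcal{T}|}-A[\mathcal{T}]\big).$$
   Context: $A[\mathcal{S}]$ denotes the principal submatrix of $A$ with rows and columns indexed by $\mathcal{S}$, $I_k$ is the $k\times k$ identity matrix, and the determinant of the empty ($0\times0$) matrix is $1$. *)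

theory Defs
  imports
    "Jordan_Normal_Form.Determinant"
    "Jordan_Normal_Form.Schur_Decomposition"
    "Jordan_Normal_Form.DL_Submatrix"
begin

definition hermitian_mat :: "complex mat \<Rightarrow> bool" where
  "hermitian_mat A \<longleftrightarrow> mat_adjoint A = A"

(* Matrix indices are 0-based, so the index set {1,...,n} becomes {0..<n}. *)
definition principal_submatrix :: "'a mat \<Rightarrow> nat set \<Rightarrow> 'a mat" where
  "principal_submatrix A S = submatrix A S S"

(* The order on complex numbers is the one of HOL-Library.Complex_Order:
   x \<le> y iff Re x \<le> Re y and Im x = Im y.  By the following lemma the determinants
   compared with it are real, so there it is the usual order of the reals. *)
lemma det_principal_submatrix_real:
  assumes A: "A \<in> carrier_mat n n" and H: "hermitian_mat A" and S: "S \<subseteq> {0..<n}"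
  shows "det (complex_of_real z \<cdot>\<^sub>m 1\<^sub>m (card S) - principal_submatrix A S) \<in> \<real>"
proof -
  define M where "M = complex_of_real z \<cdot>\<^sub>m 1\<^sub>m (card S) - principal_submatrix A S"
  have Scol: "{i. i < n \<and> i \<in> S} = S" using S by auto
  have nA: "dim_row A = n" "dim_col A = n" using A by simp_all
  have dim: "principal_submatrix A S \<in> carrier_mat (card S) (card S)"
    unfolding principal_submatrix_def by (rule carrier_matI) (simp_all only: dim_submatrix nA Scol)
  then have M: "M \<in> carrier_mat (card S) (card S)"
    unfolding M_def by auto
  have adj: "A $$ (i, j) = cnj (A $$ (j, i))" if "i < n" "j < n" for i j
  proof -
    have "A $$ (i, j) = mat_adjoint A $$ (i, j)" using H by (simp add: hermitian_mat_def)
    also have "\<dots> = cnj (A $$ (j, i))"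
      using A that by (simp add: mat_adjoint_def mat_of_rows_def)
    finally show ?thesis .
  qed
  have pick: "pick S i < n" if "i < card S" for i
    using pick_in_set_le[OF that] S by auto
  have sub: "principal_submatrix A S $$ (i, j) = A $$ (pick S i, pick S j)"
    if "i < card S" "j < card S" for i j
    unfolding principal_submatrix_def
    by (rule submatrix_index) (simp_all only: nA Scol that)
  have "map_mat cnj M = transpose_mat M"
  proof (rule eq_matI)
    fix i j assume "i < dim_row (transpose_mat M)" "j < dim_col (transpose_mat M)"
    then have ij: "i < card S" "j < card S" using M by auto
    then have "cnj (principal_submatrix A S $$ (i, j)) = principal_submatrix A S $$ (j, i)"
      using sub adj[OF pick pick, of j i] by simp
    then show "map_mat cnj M $$ (i, j) = transpose_mat M $$ (i, j)"
      using ij M dim unfolding M_def by auto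
  qed (use M in auto)
  moreover have "det (map_mat cnj M) = cnj (det M)"
  proof -
    interpret cnj_hom: comm_ring_hom cnj by unfold_locales auto
    show ?thesis by simp
  qed
  ultimately have "cnj (det M) = det M"
    using det_transpose[OF M] by simp
  then show ?thesis unfolding M_def by (simp add: Reals_cnj_iff)
qed

end

theory Submission
  imports Defs "Jordan_Normal_Form.Char_Poly"
begin

text \<open>
  Write $M = zI - A[\mathcal{S} \cup \mathcal{T}]$ with the two indices outside
  $\mathcal{S} \cap \mathcal{T}$ moved to the end.  The Desnanot--Jacobi identity expresses the
  difference of the two sides as the product of the two mixed cofactors of $M$.  As $M$ is
  Hermitian, these are complex conjugates of each other, so their product is nonnegative.
\<close>

lemma det_2:
  fixes A :: "'a::comm_ring_1 mat"
  assumes A: "A \<in> carrier_mat 2 2"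
  shows "det A = A $$ (0,0) * A $$ (1,1) - A $$ (0,1) * A $$ (1,0)"
proof -
  have "mat_delete A 0 0 \<in> carrier_mat 1 1" "mat_delete A 0 1 \<in> carrier_mat 1 1"
    using A by (auto simp: mat_delete_def)
  then have "det (mat_delete A 0 0) = A $$ (1,1)" "det (mat_delete A 0 1) = A $$ (1,0)"
    using A by (auto simp: det_single mat_delete_def)
  then show ?thesis
    using laplace_expansion_row[OF A, of 0]
    by (simp add: cofactor_def numeral_2_eq_2)
qed

text \<open>Replace the last two columns of the identity by those of the adjugate and multiply by
  \<open>M\<close> on the left. Since \<open>M * adj_mat M\<close> is \<open>det M\<close> times the
  identity, the product is block lower triangular, and its determinant can be computed in two ways.
  A factor \<open>det M\<close> stays on both sides, as it may vanish here.\<close>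

lemma det_mult_jacobi:
  fixes M :: "'a::idom mat"
  assumes M: "M \<in> carrier_mat (k+2) (k+2)"
  shows "det M * (cofactor M k k * cofactor M (k+1) (k+1) - cofactor M k (k+1) * cofactor M (k+1) k)
    = det M * (det M * det (mat k k (\<lambda>(i,j). M $$ (i,j))))"
proof -
  let ?d = "det M" and ?C = "adj_mat M" and ?B = "mat k k (\<lambda>(i,j). M $$ (i,j))"
  let ?X = "mat k 2 (\<lambda>(i,j). ?C $$ (i, k+j))" and ?Y = "mat 2 2 (\<lambda>(i,j). ?C $$ (k+i, k+j))"
  let ?D = "mat 2 k (\<lambda>(i,j). M $$ (k+i, j))"
  define N where "N = four_block_mat (1\<^sub>m k) ?X (0\<^sub>m 2 k) ?Y"
  have C: "?C \<in> carrier_mat (k+2) (k+2)" and MC: "M * ?C = ?d \<cdot>\<^sub>m 1\<^sub>m (k+2)"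
    using adj_mat[OF M] by auto
  have N: "N \<in> carrier_mat (k+2) (k+2)" unfolding N_def by auto
  \<comment> \<open>Unit columns of \<open>N\<close> copy columns of \<open>M\<close> into
    \<open>M * N\<close>; adjugate columns produce \<open>det M\<close> times unit vectors.\<close>
  have col_N: "col N j = (if j < k then unit_vec (k+2) j else col ?C j)" if "j < k+2" for j
    using that C by (auto intro!: eq_vecI simp: N_def)
  have MN: "M * N = four_block_mat ?B (0\<^sub>m k 2) ?D (?d \<cdot>\<^sub>m 1\<^sub>m 2)"
  proof (rule eq_matI)
    fix i j
    assume "i < dim_row (four_block_mat ?B (0\<^sub>m k 2) ?D (?d \<cdot>\<^sub>m 1\<^sub>m 2))"
      "j < dim_col (four_block_mat ?B (0\<^sub>m k 2) ?D (?d \<cdot>\<^sub>m 1\<^sub>m 2))"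
    then have ij: "i < k+2" "j < k+2" by auto
    have "(M * N) $$ (i,j) = row M i \<bullet> col N j" using M N ij by simp
    also have "\<dots> = (if j < k then M $$ (i,j) else (M * ?C) $$ (i,j))"
      using M C ij by (simp add: col_N)
    also have "\<dots> = (if j < k then M $$ (i,j) else if i = j then ?d else 0)"
      using ij by (simp add: MC)
    also have "\<dots> = four_block_mat ?B (0\<^sub>m k 2) ?D (?d \<cdot>\<^sub>m 1\<^sub>m 2) $$ (i,j)"
      using ij by auto
    finally show "(M * N) $$ (i,j) = four_block_mat ?B (0\<^sub>m k 2) ?D (?d \<cdot>\<^sub>m 1\<^sub>m 2) $$ (i,j)" .
  qed (use M N in auto)
  have "det (M * N) = det ?B * ?d\<^sup>2"
    unfolding MN by (subst det_four_block_mat_upper_right_zero[of _ k _ 2]) auto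
  moreover have "det (M * N) = ?d * det N" by (rule det_mult[OF M N])
  moreover have "det N = det ?Y"
    unfolding N_def by (subst det_four_block_mat_lower_left_zero[of _ k _ 2]) auto
  \<comment> \<open>The adjugate is the transposed cofactor matrix; in a determinant of size 2 this
    merely swaps two commuting factors.\<close>
  moreover have "det ?Y = cofactor M k k * cofactor M (k+1) (k+1)
      - cofactor M k (k+1) * cofactor M (k+1) k"
    using M by (subst det_2) (auto simp: adj_mat_def)
  ultimately show ?thesis by (simp add: power2_eq_square ac_simps)
qed

text \<open>Serves to carry cofactors over the polynomial ring back to the base ring by evaluation
  at 0.\<close>

lemma (in comm_ring_hom) hom_cofactor:
  assumes "A \<in> carrier_mat n n" "i < n" "j < n"
  shows "cofactor (map_mat hom A) i j = hom (cofactor A i j)"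
proof -
  have "mat_delete (map_mat hom A) i j = map_mat hom (mat_delete A i j)"
    using assms by (intro eq_matI) (auto simp: mat_delete_def)
  then show ?thesis by (simp add: cofactor_def hom_distribs)
qed

text \<open>The factor \<^term>\<open>det M\<close> is cancelled for the matrix \<open>X I + M\<close> over the polynomial ring,
  whose determinant is monic and hence nonzero; then \<open>X\<close> is set to \<open>0\<close>.\<close>

theorem desnanot_jacobi:
  fixes M :: "'a::idom mat"
  assumes M: "M \<in> carrier_mat (k+2) (k+2)"
  shows "det M * det (mat k k (\<lambda>(i,j). M $$ (i,j)))
    = cofactor M k k * cofactor M (k+1) (k+1) - cofactor M k (k+1) * cofactor M (k+1) k"
proof -
  \<comment> \<open>\<open>char_poly_matrix\<close> is X I minus its argument, so the negation
    yields X I + \<open>M\<close>, which evaluates at 0 to \<open>M\<close> itself, without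
    signs.\<close>
  define P where "P = char_poly_matrix (- M)"
  have P: "P \<in> carrier_mat (k+2) (k+2)" using M by (simp add: P_def)
  have h: "comm_ring_hom (\<lambda>p::'a poly. poly p 0)" by unfold_locales auto
  have PM: "map_mat (\<lambda>p. poly p 0) P = M"
    using M by (intro eq_matI) (auto simp: P_def char_poly_matrix_def)
  have PB: "map_mat (\<lambda>p. poly p 0) (mat k k (\<lambda>(i,j). P $$ (i,j))) = mat k k (\<lambda>(i,j). M $$ (i,j))"
    using P by (intro eq_matI) (auto simp: PM[symmetric])
  have "- M \<in> carrier_mat (k+2) (k+2)" using M by simp
  then have "coeff (det P) (k+2) = 1"
    unfolding P_def char_poly_def[symmetric] using degree_monic_char_poly by blast
  then have "det P \<noteq> 0" by auto
  then have "det P * det (mat k k (\<lambda>(i,j). P $$ (i,j)))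
    = cofactor P k k * cofactor P (k+1) (k+1) - cofactor P k (k+1) * cofactor P (k+1) k"
    using det_mult_jacobi[OF P] by simp
  then have "poly (det P * det (mat k k (\<lambda>(i,j). P $$ (i,j)))) 0
    = poly (cofactor P k k * cofactor P (k+1) (k+1) - cofactor P k (k+1) * cofactor P (k+1) k) 0"
    by simp
  moreover have "det M = poly (det P) 0"
    using comm_ring_hom.hom_det[OF h, of P] unfolding PM .
  moreover have "det (mat k k (\<lambda>(i,j). M $$ (i,j))) = poly (det (mat k k (\<lambda>(i,j). P $$ (i,j)))) 0"
    using comm_ring_hom.hom_det[OF h, of "mat k k (\<lambda>(i,j). P $$ (i,j))"] unfolding PB .
  moreover have "cofactor M i j = poly (cofactor P i j) 0" if "i < k+2" "j < k+2" for i j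
    using comm_ring_hom.hom_cofactor[OF h P that] unfolding PM .
  ultimately show ?thesis by simp
qed

text \<open>For Hermitian \<open>M\<close> the two minors come from matrices that are conjugate
  transposes of each other, and the sign is real and symmetric in \<open>i\<close> and
  \<open>j\<close>.\<close>

lemma cofactor_hermitian:
  assumes M: "M \<in> carrier_mat n n" and "i < n" "j < n"
    and H: "\<And>i j. i < n \<Longrightarrow> j < n \<Longrightarrow> M $$ (i,j) = cnj (M $$ (j,i))"
  shows "cofactor M i j = cnj (cofactor M j i)"
proof -
  interpret cnj_hom: comm_ring_hom cnj by unfold_locales auto
  have D: "mat_delete M j i \<in> carrier_mat (n-1) (n-1)" using M by (rule mat_delete_carrier)
  have "mat_delete M i j = map_mat cnj (transpose_mat (mat_delete M j i))"
  proof (rule eq_matI)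
    fix a b
    assume "a < dim_row (map_mat cnj (transpose_mat (mat_delete M j i)))"
      "b < dim_col (map_mat cnj (transpose_mat (mat_delete M j i)))"
    then have "a < n-1" "b < n-1" using D by auto
    then show "mat_delete M i j $$ (a,b) = map_mat cnj (transpose_mat (mat_delete M j i)) $$ (a,b)"
      using M by (auto simp: mat_delete_def intro!: H)
  qed (use M in auto)
  then have "det (mat_delete M i j) = cnj (det (mat_delete M j i))"
    by (simp add: det_transpose[OF D])
  then show ?thesis by (simp add: cofactor_def add.commute)
qed

text \<open>Two enumerations of \<open>S\<close> differ by a permutation of the positions. It acts
  on rows and columns alike, so its sign occurs twice and cancels.\<close>

lemma det_reindex:
  fixes F :: "'b \<Rightarrow> 'b \<Rightarrow> 'a::comm_ring_1"
  assumes f: "bij_betw f {0..<k} S" and g: "bij_betw g {0..<k} S"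
  shows "det (mat k k (\<lambda>(i,j). F (f i) (f j))) = det (mat k k (\<lambda>(i,j). F (g i) (g j)))"
proof -
  \<comment> \<open>\<open>permutes\<close> requires fixed points outside the set, hence the
    identity branch.\<close>
  define p where "p i = (if i < k then inv_into {0..<k} g (f i) else i)" for i
  have "bij_betw (inv_into {0..<k} g \<circ> f) {0..<k} {0..<k}"
    using f bij_betw_inv_into[OF g] by (rule bij_betw_trans)
  then have "bij_betw p {0..<k} {0..<k}"
    by (rule bij_betw_cong[THEN iffD1, rotated]) (auto simp: p_def)
  then have p: "p permutes {0..<k}" by (rule bij_imp_permutes) (auto simp: p_def)
  then have pk: "p i < k" if "i < k" for i using permutes_in_image[OF p, of i] that by simp
  have gp: "g (p i) = f i" if "i < k" for i
    using that bij_betw_inv_into_right[OF g] bij_betwE[OF f] by (auto simp: p_def)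
  define G where "G = mat k k (\<lambda>(i,j). F (g i) (g j))"
  \<comment> \<open>Transposing after the first row permutation lets a second row permutation act on
    the columns of \<open>G\<close>.\<close>
  define H where "H = transpose_mat (mat k k (\<lambda>(i,j). G $$ (p i, j)))"
  have G: "G \<in> carrier_mat k k" and H: "H \<in> carrier_mat k k" by (auto simp: G_def H_def)
  have "mat k k (\<lambda>(i,j). F (f i) (f j)) = transpose_mat (mat k k (\<lambda>(i,j). H $$ (p i, j)))"
    by (intro eq_matI) (auto simp: H_def G_def pk gp)
  then have "det (mat k k (\<lambda>(i,j). F (f i) (f j))) = signof p * det H"
    using det_permute_rows[OF H p] by (simp add: det_transpose[of _ k])
  also have "det H = signof p * det G"
    using det_permute_rows[OF G p] by (simp add: H_def det_transpose[of _ k])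
  also have "signof p * (signof p * det G) = det G"
    by (simp add: sign_def)
  finally show ?thesis by (simp add: G_def)
qed

lemma bij_betw_pick:
  assumes "finite S"
  shows "bij_betw (pick S) {0..<card S} S"
proof -
  have inj: "inj_on (pick S) {0..<card S}"
    by (intro linorder_inj_onI') (auto dest: pick_mono_le)
  have "pick S ` {0..<card S} = S"
    using pick_in_set_le by (intro card_subset_eq[OF assms]) (auto simp: card_image[OF inj])
  with inj show ?thesis by (simp add: bij_betw_def)
qed

text \<open>\<open>submatrix\<close> lists indices in increasing order; this frees the order, so
  that the two exceptional indices can come last. The diagonal is tested on labels instead of
  positions, which is equivalent by injectivity and gives entries of the form needed for
  \<open>det_reindex\<close>.\<close>

lemma det_principal_submatrix_reindex:
  fixes A :: "'a::comm_ring_1 mat"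
  assumes A: "A \<in> carrier_mat n n" and S: "S \<subseteq> {0..<n}" and f: "bij_betw f {0..<k} S"
  shows "det (z \<cdot>\<^sub>m 1\<^sub>m (card S) - principal_submatrix A S)
    = det (mat k k (\<lambda>(i,j). (if f i = f j then z else 0) - A $$ (f i, f j)))"
proof -
  have k: "card S = k" using bij_betw_same_card[OF f] by simp
  have "finite S" using S by (rule finite_subset) simp
  then have pick: "bij_betw (pick S) {0..<k} S" using bij_betw_pick k by blast
  have "{i. i < n \<and> i \<in> S} = S" using S by auto
  then have "z \<cdot>\<^sub>m 1\<^sub>m k - principal_submatrix A S
      = mat k k (\<lambda>(i,j). (if pick S i = pick S j then z else 0) - A $$ (pick S i, pick S j))"
    using A k bij_betw_imp_inj_on[OF pick]
    by (intro eq_matI) (auto simp: principal_submatrix_def submatrix_def inj_on_eq_iff)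
  then show ?thesis
    unfolding k using det_reindex[OF pick f, of "\<lambda>a b. (if a = b then z else 0) - A $$ (a, b)"]
    by simp
qed

theorem theorem4p1:
  fixes A :: "complex mat" and n :: nat and S T :: "nat set" and z :: real
  assumes "A \<in> carrier_mat n n"
    and "hermitian_mat A"
    and "S \<subseteq> {0..<n}" and "T \<subseteq> {0..<n}"
    and "card (S \<inter> T) + 1 = card S" and "card (S \<inter> T) + 1 = card T"
  shows "det (complex_of_real z \<cdot>\<^sub>m 1\<^sub>m (card (S \<union> T)) - principal_submatrix A (S \<union> T)) *
         det (complex_of_real z \<cdot>\<^sub>m 1\<^sub>m (card (S \<inter> T)) - principal_submatrix A (S \<inter> T))
       \<le> det (complex_of_real z \<cdot>\<^sub>m 1\<^sub>m (card S) - principal_submatrix A S) *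
         det (complex_of_real z \<cdot>\<^sub>m 1\<^sub>m (card T) - principal_submatrix A T)"
proof -
  let ?W = "S \<inter> T" and ?F = "\<lambda>a b. (if a = b then complex_of_real z else 0) - A $$ (a, b)"
  define k where "k = card ?W"
  have fin: "finite S" "finite T" using assms(3,4) by (auto intro: finite_subset)
  have "card (S - ?W) = 1" "card (T - ?W) = 1"
    using assms(5,6) fin by (simp_all add: card_Diff_subset)
  then obtain s t where "S - ?W = {s}" "T - ?W = {t}" by (auto simp: card_1_singleton_iff)
  then have S: "S = insert s ?W" and T: "T = insert t ?W" and st: "s \<notin> T" "t \<notin> S" by auto
  \<comment> \<open>\<open>f\<close> lists the intersection, then \<open>s\<close>, then
    \<open>t\<close>: its initial segments of length \<open>k\<close>, \<open>k+1\<close> and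
    \<open>k+2\<close> enumerate the intersection, \<open>S\<close> and the union. \<open>g\<close>
    skips \<open>s\<close> and so enumerates \<open>T\<close>.\<close>
  define f where "f i = (if i < k then pick ?W i else if i = k then s else t)" for i
  define g where "g i = (if i < k then pick ?W i else t)" for i
  have pick: "bij_betw (pick ?W) {0..<k} ?W" using bij_betw_pick fin by (simp add: k_def)
  have fW: "bij_betw f {0..<k} ?W" and gW: "bij_betw g {0..<k} ?W"
    by (rule bij_betw_cong[THEN iffD1, OF _ pick]; simp add: f_def g_def)+
  have "bij_betw f ({0..<k} \<union> {k}) (?W \<union> {f k})"
    using st by (intro notIn_Un_bij_betw fW) (auto simp: f_def)
  then have fS: "bij_betw f {0..<k+1} S"
    using S by (simp add: f_def atLeast0_lessThan_Suc)
  have "bij_betw g ({0..<k} \<union> {k}) (?W \<union> {g k})"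
    using st by (intro notIn_Un_bij_betw gW) (auto simp: g_def)
  then have gT: "bij_betw g {0..<k+1} T"
    using T by (simp add: g_def atLeast0_lessThan_Suc)
  have "bij_betw f ({0..<k+1} \<union> {k+1}) (S \<union> {f (k+1)})"
    using st by (intro notIn_Un_bij_betw fS) (auto simp: f_def)
  moreover have "S \<union> {t} = S \<union> T" using T by auto
  ultimately have fU: "bij_betw f {0..<k+2} (S \<union> T)"
    by (simp add: f_def atLeast0_lessThan_Suc numeral_2_eq_2)

  define M where "M = mat (k+2) (k+2) (\<lambda>(i,j). ?F (f i) (f j))"
  have M: "M \<in> carrier_mat (k+2) (k+2)" by (simp add: M_def)
  have subsets: "S \<union> T \<subseteq> {0..<n}" "S \<inter> T \<subseteq> {0..<n}" using assms(3,4) by auto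
  note det_eq = det_principal_submatrix_reindex[OF assms(1), where z = "complex_of_real z"]
  have U: "det (complex_of_real z \<cdot>\<^sub>m 1\<^sub>m (card (S \<union> T)) - principal_submatrix A (S \<union> T)) = det M"
    using det_eq[OF subsets(1) fU] by (simp add: M_def)
  have "mat k k (\<lambda>(i,j). M $$ (i,j)) = mat k k (\<lambda>(i,j). ?F (f i) (f j))"
    by (intro eq_matI) (auto simp: M_def)
  then have W: "det (complex_of_real z \<cdot>\<^sub>m 1\<^sub>m (card ?W) - principal_submatrix A ?W)
      = det (mat k k (\<lambda>(i,j). M $$ (i,j)))"
    using det_eq[OF subsets(2) fW] by simp
  have "mat_delete M (k+1) (k+1) = mat (k+1) (k+1) (\<lambda>(i,j). ?F (f i) (f j))"
    by (intro eq_matI) (auto simp: M_def mat_delete_def)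
  then have cS: "det (complex_of_real z \<cdot>\<^sub>m 1\<^sub>m (card S) - principal_submatrix A S)
      = cofactor M (k+1) (k+1)"
    using det_eq[OF assms(3) fS] by (simp add: cofactor_def)
  \<comment> \<open>Deleting position \<open>k\<close> removes \<open>s\<close> and moves
    \<open>t\<close> from position \<open>k+1\<close> to \<open>k\<close>, which is the order of
    \<open>g\<close>. Diagonal cofactors carry the sign +1.\<close>
  have "mat_delete M k k = mat (k+1) (k+1) (\<lambda>(i,j). ?F (g i) (g j))"
    by (intro eq_matI) (auto simp: M_def mat_delete_def f_def g_def)
  then have cT: "det (complex_of_real z \<cdot>\<^sub>m 1\<^sub>m (card T) - principal_submatrix A T)
      = cofactor M k k"
    using det_eq[OF assms(4) gT] by (simp add: cofactor_def)

  have adj: "A $$ (i, j) = cnj (A $$ (j, i))" if "i < n" "j < n" for i j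
  proof -
    have "A $$ (i, j) = mat_adjoint A $$ (i, j)" using assms(2) by (simp add: hermitian_mat_def)
    also have "\<dots> = cnj (A $$ (j, i))"
      using assms(1) that by (simp add: mat_adjoint_def mat_of_rows_def)
    finally show ?thesis .
  qed
  have fn: "f i < n" if "i < k+2" for i
  proof -
    have "f i \<in> S \<union> T" using bij_betwE[OF fU] that by simp
    then show ?thesis using subsets(1) by auto
  qed
  \<comment> \<open>On the diagonal this relies on \<open>z\<close> being real.\<close>
  have H: "M $$ (i, j) = cnj (M $$ (j, i))" if "i < k+2" "j < k+2" for i j
    using that adj[OF fn fn, of i j] by (simp add: M_def)
  have "cofactor M (k+1) k = cnj (cofactor M k (k+1))"
    by (rule cofactor_hermitian[OF M _ _ H]) simp_all
  then have "det M * det (mat k k (\<lambda>(i,j). M $$ (i,j)))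
      = cofactor M (k+1) (k+1) * cofactor M k k - complex_of_real ((cmod (cofactor M k (k+1)))\<^sup>2)"
    using desnanot_jacobi[OF M] by (simp only: complex_norm_square mult.commute)
  \<comment> \<open>The two sides differ by a squared modulus, so their imaginary parts agree and
    their real parts are ordered.\<close>
  then show ?thesis
    unfolding U W cS cT by (simp add: less_eq_complex_def)
qed

end
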